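(* Let $G$ be a finite simple graph on $n$ vertices, let $G^\sigma$ be an orientation of $G$, and let $\pi(G^\sigma,x)=\sum_{k=0}^{n}a_{k}x^{n-k}$ be its permanental polynomial. Then $$a_k=\sum_{U\in\mathcal{E}\mathscr{U}_k}(-1)^{m(U)+c^{-}(U)}\,2^{c(U)}\quad\text{if } k \text{ is even},$$ and $a_k=0$ if $k$ is odd. Here $\mathcal{E}\mathscr{U}_k$ is the set of all Sachs subgraphs of $G$ on exactly $k$ vertices with no odd cycles, $m(U)$ is the number of single edges of $U$ (components of $U$ that are a single edge), $c(U)$ is the number of cycles of $U$, and $c^{-}(U)$ is the number of cycles of $U$ that are oddly oriented relative to $G^\sigma$.
   Context: An orientation $G^\sigma$ of a simple graph $G$ with vertex set $\{v_1,\dots,v_n\}$ assigns to each edge of $G$ one of its two directions, making $G$ a directed graph. The skew adjacency matrix $A_s(G^\sigma)=(a_{ij})$ is the $n\times n$ matrix with $a_{ij}=1$ if $(v_i,v_j)$ is an arc of $G^\sigma$, $a_{ij}=-1$ if $(v_j,v_i)$ is an arc of $G^\sigma$, and $a_{ij}=0$ otherwise. The permanent of $M=(m_{ij})$ is $\mathrm{per}(M)=\sum_{\pi\in S_n}\prod_{i=1}^{n}m_{i\pi(i)}$, and the permanental polynomial of $G^\sigma$ is $\pi(G^\sigma,x)=\mathrm{per}(xI-A_s(G^\sigma))$. A Sachs graph is an undirected graph in which each component is a single edge ($K_2$) or a cycle (of length at least 3). A Sachs subgraph of $G$ is a (not necessarily induced) subgraph of $G$ that is a Sachs graph; for $k=0$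 the empty graph is the only one. An even cycle $C$ of $G$ is oddly (resp. evenly) oriented relative to $G^\sigma$ if, for either choice of direction of traversal around $C$, the number of edges of $C$ whose orientation in $G^\sigma$ agrees with the direction of traversal is odd (resp. even). *)

theory Defs
  imports Jordan_Normal_Form.Matrix "HOL-Computational_Algebra.Polynomial" "HOL-Combinatorics.Permutations"
begin

text \<open>An undirected graph is a pair of a vertex set and a set of two-element subsets of it;
  \<open>simple_graph\<close> also requires finiteness.\<close>

type_synonym 'a ugraph = "'a set \<times> 'a set set"

abbreviation vertices :: "'a ugraph \<Rightarrow> 'a set" where "vertices G \<equiv> fst G"
abbreviation edges :: "'a ugraph \<Rightarrow> 'a set set" where "edges G \<equiv> snd G"

definition simple_graph :: "'a ugraph \<Rightarrow> bool" where
  "simple_graph G \<longleftrightarrow> finite (vertices G) \<and> (\<forall>e\<in>edges G. e \<subseteq> vertices G \<and> card e = 2)"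

definition is_subgraph :: "'a ugraph \<Rightarrow> 'a ugraph \<Rightarrow> bool" where
  "is_subgraph H G \<longleftrightarrow> simple_graph H \<and> vertices H \<subseteq> vertices G \<and> edges H \<subseteq> edges G"

definition connection :: "'a ugraph \<Rightarrow> ('a \<times> 'a) set" where
  "connection G = {(u, v). u \<in> vertices G \<and> v \<in> vertices G \<and> (u, v) \<in> {(x, y). {x, y} \<in> edges G}\<^sup>*}"

definition components :: "'a ugraph \<Rightarrow> 'a ugraph set" where
  "components G = (\<lambda>C. (C, {e \<in> edges G. e \<subseteq> C})) ` (vertices G // connection G)"

definition is_single_edge :: "'a ugraph \<Rightarrow> bool" where
  "is_single_edge H \<longleftrightarrow> (\<exists>u v. u \<noteq> v \<and> H = ({u, v}, {{u, v}}))"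

text \<open>\<open>traversal xs H\<close>: the list \<open>xs\<close> visits the vertices of the cycle \<open>H\<close> once around, from some
  starting vertex and in one of the two directions; its steps are the pairs of cyclically
  consecutive vertices.\<close>

definition steps :: "'a list \<Rightarrow> ('a \<times> 'a) set" where
  "steps xs = {(xs ! i, xs ! (Suc i mod length xs)) | i. i < length xs}"

definition traversal :: "'a list \<Rightarrow> 'a ugraph \<Rightarrow> bool" where
  "traversal xs H \<longleftrightarrow> distinct xs \<and> 3 \<le> length xs \<and>
     H = (set xs, {{x, y} | x y. (x, y) \<in> steps xs})"

definition is_cycle :: "'a ugraph \<Rightarrow> bool" where
  "is_cycle H \<longleftrightarrow> (\<exists>xs. traversal xs H)"

definition is_sachs_graph :: "'a ugraph \<Rightarrow> bool" where
  "is_sachs_graph U \<longleftrightarrow> simple_graph U \<and> (\<forall>C\<in>components U. is_single_edge C \<or> is_cycle C)"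

definition cycles :: "'a ugraph \<Rightarrow> 'a ugraph set" where
  "cycles U = {C \<in> components U. is_cycle C}"

definition even_sachs_subgraphs :: "'a ugraph \<Rightarrow> nat \<Rightarrow> 'a ugraph set" where
  "even_sachs_subgraphs G k = {U. is_subgraph U G \<and> is_sachs_graph U \<and> card (vertices U) = k \<and>
     (\<forall>C\<in>cycles U. even (card (vertices C)))}"

text \<open>An orientation of \<open>G\<close> is given by its set of arcs, each edge contributing exactly one of its
  two directions.\<close>

definition is_orientation :: "('a \<times> 'a) set \<Rightarrow> 'a ugraph \<Rightarrow> bool" where
  "is_orientation D G \<longleftrightarrow> (\<forall>u v. (u, v) \<in> D \<longrightarrow> {u, v} \<in> edges G) \<and>
     (\<forall>u v. {u, v} \<in> edges G \<longrightarrow> ((u, v) \<in> D) \<noteq> ((v, u) \<in> D))"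

text \<open>Meaningful for even cycles only: there the parity of the number of agreeing edges is the same
  for both directions.\<close>

definition oddly_oriented :: "('a \<times> 'a) set \<Rightarrow> 'a ugraph \<Rightarrow> bool" where
  "oddly_oriented D C \<longleftrightarrow> (\<forall>xs. traversal xs C \<longrightarrow> odd (card (steps xs \<inter> D)))"

definition num_single_edges :: "'a ugraph \<Rightarrow> nat" where
  "num_single_edges U = card {C \<in> components U. is_single_edge C}"

definition num_cycles :: "'a ugraph \<Rightarrow> nat" where
  "num_cycles U = card (cycles U)"

definition num_oddly_oriented_cycles :: "('a \<times> 'a) set \<Rightarrow> 'a ugraph \<Rightarrow> nat" where
  "num_oddly_oriented_cycles D U = card {C \<in> cycles U. oddly_oriented D C}"

text \<open>The labelling \<open>v\<close> enumerates the vertices as \<open>v 0, \<dots>, v (n - 1)\<close>, following the 0-based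
  matrix indices of the library.\<close>

definition skew_adj_mat :: "nat \<Rightarrow> (nat \<Rightarrow> 'a) \<Rightarrow> ('a \<times> 'a) set \<Rightarrow> int mat" where
  "skew_adj_mat n v D = mat n n (\<lambda>(i, j).
     if (v i, v j) \<in> D then 1 else if (v j, v i) \<in> D then -1 else 0)"

text \<open>Intended for square matrices.\<close>

definition permanent :: "'a::comm_ring_1 mat \<Rightarrow> 'a" where
  "permanent M = (\<Sum>p | p permutes {0..<dim_row M}. \<Prod>i = 0..<dim_row M. M $$ (i, p i))"

definition permanental_poly :: "nat \<Rightarrow> (nat \<Rightarrow> 'a) \<Rightarrow> ('a \<times> 'a) set \<Rightarrow> int poly" where
  "permanental_poly n v D =
     permanent ([:0, 1:] \<cdot>\<^sub>m 1\<^sub>m n - map_mat (\<lambda>c. [:c:]) (skew_adj_mat n v D))"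

end

theory Submission
  imports Defs "HOL-Combinatorics.Cycles"
begin

text \<open>A permutation with nonzero weight moves every non-fixed vertex along an edge, so it traces out
  a subgraph \<open>U\<close> of \<open>G\<close> on its non-fixed vertices, and \<open>a k\<close> is the sum over all \<open>U\<close> on \<open>k\<close> vertices
  of the total weight of the permutations tracing \<open>U\<close>. This total weight is multiplicative over
  the components of \<open>U\<close>. A connected graph traced by \<open>p\<close> is a single edge or a cycle, and is traced
  only by \<open>p\<close> and its inverse. These coincide for a single edge, giving the factor \<open>-1\<close>; for a
  cycle they differ, and their weights cancel if its length is odd and agree if it is even.\<close>

unbundle no m_inv_syntax

section \<open>Permutations tracing the edges of a graph\<close>

text \<open>The off-diagonal entry of xI - A_s, that is, the negated skew adjacency entry; hence an
  arc counts as -1.\<close>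

definition arc_sign :: "('a \<times> 'a) set \<Rightarrow> 'a \<Rightarrow> 'a \<Rightarrow> int" where
  "arc_sign D x y = (if (x, y) \<in> D then -1 else if (y, x) \<in> D then 1 else 0)"

text \<open>Edges are unordered pairs, so \<open>p\<close> and its inverse trace the same graph, and
  a transposition traces a single edge.\<close>

definition edge_perms :: "'a ugraph \<Rightarrow> ('a \<Rightarrow> 'a) set" where
  "edge_perms U = {p. p permutes vertices U \<and> (\<forall>x\<in>vertices U. p x \<noteq> x) \<and>
     edges U = (\<lambda>x. {x, p x}) ` vertices U}"

text \<open>The product runs over the moved points, not over a vertex set, so the weight is the same
  whether \<open>p\<close> is read as a permutation of a subgraph or of all of
  \<open>G\<close>.\<close>

definition perm_weight :: "('a \<times> 'a) set \<Rightarrow> ('a \<Rightarrow> 'a) \<Rightarrow> int" where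
  "perm_weight D p = (\<Prod>x | p x \<noteq> x. arc_sign D x (p x))"

definition graph_weight :: "('a \<times> 'a) set \<Rightarrow> 'a ugraph \<Rightarrow> int" where
  "graph_weight D U = (\<Sum>p\<in>edge_perms U. perm_weight D p)"

lemma finite_edge_perms:
  assumes "finite (vertices U)"
  shows "finite (edge_perms U)"
  by (rule finite_subset[OF _ finite_permutations[OF assms]]) (auto simp: edge_perms_def)

lemma edge_perms_moved:
  assumes "p \<in> edge_perms U"
  shows "{x. p x \<noteq> x} = vertices U"
  using assms unfolding edge_perms_def permutes_def by auto

lemma perm_weight_edge_perms:
  assumes "p \<in> edge_perms U"
  shows "perm_weight D p = (\<Prod>x\<in>vertices U. arc_sign D x (p x))"
  unfolding perm_weight_def edge_perms_moved[OF assms] ..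

lemma edge_perms_edge:
  assumes "p \<in> edge_perms U" "x \<in> vertices U"
  shows "{x, p x} \<in> edges U"
  using assms unfolding edge_perms_def by auto

lemma arc_sign_swap:
  assumes "is_orientation D G"
  shows "arc_sign D y x = - arc_sign D x y"
proof -
  have "\<not> ((x, y) \<in> D \<and> (y, x) \<in> D)"
    using assms unfolding is_orientation_def by blast
  then show ?thesis by (auto simp: arc_sign_def)
qed

lemma arc_sign_edge:
  assumes "is_orientation D G" "{x, y} \<in> edges G"
  shows "arc_sign D x y = (if (x, y) \<in> D then -1 else 1)"
proof -
  have "((x, y) \<in> D) \<noteq> ((y, x) \<in> D)"
    using assms unfolding is_orientation_def by blast
  then show ?thesis by (auto simp: arc_sign_def)
qed

lemma arc_sign_eq_0:
  assumes "is_orientation D G" "{x, y} \<notin> edges G"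
  shows "arc_sign D x y = 0"
proof -
  have "{y, x} \<notin> edges G" using assms(2) by (simp add: insert_commute)
  then have "(x, y) \<notin> D" "(y, x) \<notin> D"
    using assms unfolding is_orientation_def by blast+
  then show ?thesis by (simp add: arc_sign_def)
qed

section \<open>Multiplicativity over components\<close>

definition disjoint_union :: "'a ugraph \<Rightarrow> 'a ugraph \<Rightarrow> 'a ugraph" where
  "disjoint_union U W = (vertices U \<union> vertices W, edges U \<union> edges W)"

text \<open>The restriction is an injective self-map of a finite set, hence onto.\<close>

lemma permutes_restrict:
  assumes "p permutes S" "T \<subseteq> S" "finite T" "p ` T \<subseteq> T"
  shows "(\<lambda>x. if x \<in> T then p x else x) permutes T"
proof (rule bij_imp_permutes)
  have "inj_on p T" using permutes_inj_on[OF assms(1)] .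
  then have "bij_betw p T T"
    using assms(3,4) by (simp add: bij_betw_def endo_inj_surj)
  then show "bij_betw (\<lambda>x. if x \<in> T then p x else x) T T"
    by (subst bij_betw_cong[where g = p]) auto
qed auto

text \<open>No edge joins the two vertex sets, so the edge from \<open>x\<close> to
  \<open>p x\<close> stays on the side of \<open>x\<close> and \<open>p\<close> preserves each side;
  conversely an edge of \<open>U\<close> can only be traced from a vertex of
  \<open>U\<close>.\<close>

lemma edge_perms_disjoint_union_restrict:
  assumes U: "simple_graph U" and W: "simple_graph W"
    and disj: "vertices U \<inter> vertices W = {}"
    and p: "p \<in> edge_perms (disjoint_union U W)"
  shows "(\<lambda>x. if x \<in> vertices U then p x else x) \<in> edge_perms U"
proof -
  let ?V = "vertices U"
  have E: "edges U \<union> edges W = (\<lambda>x. {x, p x}) ` (?V \<union> vertices W)"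
    and perm: "p permutes ?V \<union> vertices W"
    and nofix: "\<forall>x\<in>?V \<union> vertices W. p x \<noteq> x"
    using p by (auto simp: edge_perms_def disjoint_union_def)
  have subU: "e \<subseteq> ?V" if "e \<in> edges U" for e using U that by (auto simp: simple_graph_def)
  have subW: "e \<subseteq> vertices W" if "e \<in> edges W" for e using W that by (auto simp: simple_graph_def)
  have edge: "{x, p x} \<in> edges U" if "x \<in> ?V" for x
  proof -
    have "{x, p x} \<in> edges U \<union> edges W" unfolding E using that by blast
    then show ?thesis using subW that disj by blast
  qed
  have "p ` ?V \<subseteq> ?V" using edge subU by blast
  then have "(\<lambda>x. if x \<in> ?V then p x else x) permutes ?V"
    using permutes_restrict[OF perm] U by (auto simp: simple_graph_def)
  moreover have "edges U = (\<lambda>x. {x, p x}) ` ?V"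
  proof
    show "edges U \<subseteq> (\<lambda>x. {x, p x}) ` ?V"
    proof
      fix e assume e: "e \<in> edges U"
      then obtain x where "x \<in> ?V \<union> vertices W" "e = {x, p x}" using E by blast
      then show "e \<in> (\<lambda>x. {x, p x}) ` ?V" using subU[OF e] by blast
    qed
  qed (use edge in blast)
  ultimately show ?thesis using nofix by (auto simp: edge_perms_def)
qed

lemma disjoint_union_commute: "disjoint_union U W = disjoint_union W U"
  by (auto simp: disjoint_union_def)

lemma edge_perms_disjoint_union_glue:
  assumes disj: "vertices U \<inter> vertices W = {}"
    and p: "p \<in> edge_perms U" and q: "q \<in> edge_perms W"
  shows "(\<lambda>x. if x \<in> vertices U then p x else q x) \<in> edge_perms (disjoint_union U W)"
proof -
  have pp: "p permutes vertices U" and qp: "q permutes vertices W"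
    using p q by (auto simp: edge_perms_def)
  let ?r = "\<lambda>x. if x \<in> vertices U then p x else q x"
  have "q x = x" if "x \<in> vertices U" for x
    using qp that disj by (auto simp: permutes_def)
  moreover have "p x = x" if "x \<notin> vertices U" for x
    using pp that by (auto simp: permutes_def)
  moreover have "q x \<notin> vertices U" if "x \<notin> vertices U" for x
    using permutes_in_image[OF qp, of x] that disj qp unfolding permutes_def by (cases "x \<in> vertices W") auto
  \<comment> \<open>The moved points of \<open>p\<close> and \<open>q\<close> are disjoint, so the
    piecewise map is a composition and thereby a permutation of the union.\<close>
  ultimately have r: "?r = p \<circ> q" by (auto simp: fun_eq_iff)
  have "?r permutes vertices U \<union> vertices W"
    unfolding r using pp qp by (meson permutes_compose permutes_subset sup_ge1 sup_ge2)
  moreover have "edges U \<union> edges W = (\<lambda>x. {x, ?r x}) ` (vertices U \<union> vertices W)"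
  proof -
    have "(\<lambda>x. {x, ?r x}) ` vertices U = edges U"
      using p by (auto simp: edge_perms_def)
    moreover have "(\<lambda>x. {x, ?r x}) ` vertices W = (\<lambda>x. {x, q x}) ` vertices W"
      using disj by (intro image_cong) auto
    ultimately show ?thesis using q by (auto simp: edge_perms_def image_Un)
  qed
  ultimately show ?thesis
    using p q by (auto simp: edge_perms_def disjoint_union_def)
qed

text \<open>Gluing and restricting are mutually inverse between pairs of tracing permutations and
  tracing permutations of the union, and the weight of a glued permutation is the product of the two
  weights.\<close>

lemma graph_weight_disjoint_union:
  assumes U: "simple_graph U" and W: "simple_graph W"
    and disj: "vertices U \<inter> vertices W = {}"
  shows "graph_weight D (disjoint_union U W) = graph_weight D U * graph_weight D W"
proof -
  let ?glue = "\<lambda>(p, q) x. if x \<in> vertices U then p x else q x"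
  have fin: "finite (vertices U)" "finite (vertices W)"
    using U W by (auto simp: simple_graph_def)
  have "graph_weight D U * graph_weight D W =
      (\<Sum>(p, q)\<in>edge_perms U \<times> edge_perms W. perm_weight D p * perm_weight D q)"
    by (simp add: graph_weight_def sum_product sum.cartesian_product)
  also have "\<dots> = (\<Sum>r\<in>edge_perms (disjoint_union U W). perm_weight D r)"
  proof (rule sum.reindex_bij_witness[where j = ?glue and
        i = "\<lambda>r. (\<lambda>x. if x \<in> vertices U then r x else x, \<lambda>x. if x \<in> vertices W then r x else x)"])
    fix r assume r: "r \<in> edge_perms (disjoint_union U W)"
    have "r x = x" if "x \<notin> vertices U" "x \<notin> vertices W" for x
      using r that by (auto simp: edge_perms_def disjoint_union_def permutes_def)
    then show "?glue (\<lambda>x. if x \<in> vertices U then r x else x, \<lambda>x. if x \<in> vertices W then r x else x) = r"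
      by (auto simp: fun_eq_iff)
    show "(\<lambda>x. if x \<in> vertices U then r x else x, \<lambda>x. if x \<in> vertices W then r x else x)
        \<in> edge_perms U \<times> edge_perms W"
      using edge_perms_disjoint_union_restrict[OF U W disj r]
        edge_perms_disjoint_union_restrict[OF W U, of r] disj r
      by (simp add: disjoint_union_commute Int_commute)
  next
    fix pq assume "pq \<in> edge_perms U \<times> edge_perms W"
    then obtain p q where pq: "pq = (p, q)" "p \<in> edge_perms U" "q \<in> edge_perms W" by auto
    have "p x = x" if "x \<notin> vertices U" for x
      using pq that by (auto simp: edge_perms_def permutes_def)
    moreover have "q x = x" if "x \<notin> vertices W" for x
      using pq that by (auto simp: edge_perms_def permutes_def)
    ultimately show "((\<lambda>x. if x \<in> vertices U then ?glue pq x else x,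
        \<lambda>x. if x \<in> vertices W then ?glue pq x else x)) = pq"
      using disj pq(1) by (auto simp: fun_eq_iff)
    show glue: "?glue pq \<in> edge_perms (disjoint_union U W)"
      using edge_perms_disjoint_union_glue[OF disj pq(2,3)] pq(1) by simp
    have "perm_weight D (?glue pq) = (\<Prod>x\<in>vertices U \<union> vertices W. arc_sign D x (?glue pq x))"
      using perm_weight_edge_perms[OF glue] by (simp add: disjoint_union_def)
    also have "\<dots> = (\<Prod>x\<in>vertices U. arc_sign D x (?glue pq x)) *
        (\<Prod>x\<in>vertices W. arc_sign D x (?glue pq x))"
      by (rule prod.union_disjoint[OF fin disj])
    also have "(\<Prod>x\<in>vertices U. arc_sign D x (?glue pq x)) = perm_weight D p"
      unfolding perm_weight_edge_perms[OF pq(2)] by (rule prod.cong) (auto simp: pq)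
    also have "(\<Prod>x\<in>vertices W. arc_sign D x (?glue pq x)) = perm_weight D q"
      unfolding perm_weight_edge_perms[OF pq(3)] by (rule prod.cong) (use disj in \<open>auto simp: pq\<close>)
    finally show "perm_weight D (?glue pq) = (case pq of (p, q) \<Rightarrow> perm_weight D p * perm_weight D q)"
      by (simp add: pq)
  qed
  finally show ?thesis by (simp add: graph_weight_def)
qed

lemma graph_weight_empty: "graph_weight D ({}, {}) = 1"
proof -
  have "edge_perms ({}, {}) = {id :: 'a \<Rightarrow> 'a}" by (auto simp: edge_perms_def)
  then show ?thesis by (simp add: graph_weight_def perm_weight_def)
qed

lemma graph_weight_Union:
  assumes "finite S" "\<And>C. C \<in> S \<Longrightarrow> simple_graph C"
    and "\<And>C C'. C \<in> S \<Longrightarrow> C' \<in> S \<Longrightarrow> C \<noteq> C' \<Longrightarrow> vertices C \<inter> vertices C' = {}"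
  shows "graph_weight D (\<Union>(vertices ` S), \<Union>(edges ` S)) = (\<Prod>C\<in>S. graph_weight D C)"
  using assms
proof (induction S rule: finite_induct)
  case empty
  show ?case by (simp add: graph_weight_empty)
next
  case (insert C S)
  let ?W = "(\<Union>(vertices ` S), \<Union>(edges ` S))"
  have "simple_graph ?W"
  proof -
    have "finite (vertices C')" if "C' \<in> S" for C'
      using insert.prems(1)[of C'] that by (simp add: simple_graph_def)
    then have "finite (vertices ?W)" using insert.hyps(1) by simp
    moreover have "e \<subseteq> vertices C'" "card e = 2" if "C' \<in> S" "e \<in> edges C'" for C' e
      using insert.prems(1)[of C'] that by (simp_all add: simple_graph_def)
    note edge = this
    have "\<forall>e\<in>edges ?W. e \<subseteq> vertices ?W \<and> card e = 2"
    proof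
      fix e assume "e \<in> edges ?W"
      then obtain C' where C': "C' \<in> S" "e \<in> edges C'" by auto
      have "vertices C' \<subseteq> vertices ?W" using C'(1) by (simp add: UN_upper)
      then show "e \<subseteq> vertices ?W \<and> card e = 2" using edge[OF C'] by blast
    qed
    ultimately show ?thesis unfolding simple_graph_def ..
  qed
  moreover have "vertices C \<inter> vertices ?W = {}"
  proof -
    have "vertices C \<inter> vertices C' = {}" if "C' \<in> S" for C'
      using insert.prems(2)[of C C'] insert.hyps(2) that by blast
    then show ?thesis by (simp add: Int_UN_distrib)
  qed
  ultimately have "graph_weight D (disjoint_union C ?W) = graph_weight D C * graph_weight D ?W"
    by (rule graph_weight_disjoint_union[OF insert.prems(1)[OF insertI1]])
  moreover have "disjoint_union C ?W = (\<Union>(vertices ` insert C S), \<Union>(edges ` insert C S))"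
    by (simp add: disjoint_union_def)
  moreover have "graph_weight D ?W = (\<Prod>C\<in>S. graph_weight D C)"
    by (rule insert.IH) (use insert.prems in blast)+
  ultimately show ?case using insert.hyps by simp
qed

section \<open>Components as classes of reachability\<close>

lemma equiv_connection: "equiv (vertices U) (connection U)"
proof -
  let ?R = "{(x, y). {x, y} \<in> edges U}"
  have "sym ?R" by (auto simp: sym_def insert_commute)
  then have sym: "sym (?R\<^sup>*)" by (rule sym_rtrancl)
  show ?thesis
  proof (rule equivI)
    show "connection U \<subseteq> vertices U \<times> vertices U" by (auto simp: connection_def)
    show "refl_on (vertices U) (connection U)" by (auto simp: refl_on_def connection_def)
    show "sym (connection U)"
      unfolding connection_def by (rule symI) (use symD[OF sym] in blast)
    show "trans (connection U)"
      unfolding connection_def by (rule transI) (blast intro: rtrancl_trans)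
  qed
qed

lemma component_simple:
  assumes "simple_graph U" "C \<in> components U"
  shows "simple_graph C"
proof -
  obtain Q where Q: "Q \<in> vertices U // connection U" "C = (Q, {e \<in> edges U. e \<subseteq> Q})"
    using assms(2) by (auto simp: components_def)
  then have "Q \<subseteq> vertices U" by (blast dest: in_quotient_imp_subset[OF equiv_connection])
  then have "finite Q" using assms(1) finite_subset unfolding simple_graph_def by blast
  then show ?thesis using assms(1) Q(2) by (auto simp: simple_graph_def)
qed

lemma component_subgraph:
  assumes "C \<in> components U"
  shows "edges C \<subseteq> edges U" "vertices C \<subseteq> vertices U"
  using assms by (auto simp: components_def dest!: in_quotient_imp_subset[OF equiv_connection])

lemma components_disjoint:
  assumes "C \<in> components U" "C' \<in> components U" "C \<noteq> C'"
  shows "vertices C \<inter> vertices C' = {}"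
proof -
  obtain Q Q' where Q: "Q \<in> vertices U // connection U" "C = (Q, {e \<in> edges U. e \<subseteq> Q})"
    "Q' \<in> vertices U // connection U" "C' = (Q', {e \<in> edges U. e \<subseteq> Q'})"
    using assms(1,2) by (auto simp: components_def)
  then show ?thesis using quotient_disj[OF equiv_connection Q(1,3)] assms(3) by auto
qed

lemma finite_components:
  assumes "simple_graph U"
  shows "finite (components U)"
  using assms finite_quotient[OF _ equiv_type[OF equiv_connection[of U]]]
  by (auto simp: components_def simple_graph_def)

lemma component_nonempty:
  assumes "C \<in> components U"
  shows "vertices C \<noteq> {}"
  using assms in_quotient_imp_non_empty[OF equiv_connection[of U]] by (auto simp: components_def)

text \<open>The classes cover the vertices, and the two ends of an edge are connected, so every edge
  lies inside one class.\<close>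

lemma Union_components:
  assumes "simple_graph U"
  shows "(\<Union>(vertices ` components U), \<Union>(edges ` components U)) = U"
proof -
  have V: "\<Union>(vertices ` components U) = vertices U"
    using Union_quotient[OF equiv_connection[of U]] by (simp add: components_def image_image)
  have "e \<in> \<Union>(edges ` components U)" if e: "e \<in> edges U" for e
  proof -
    have "e \<subseteq> vertices U" "card e = 2" using assms e by (auto simp: simple_graph_def)
    then obtain x y where xy: "e = {x, y}" "x \<in> vertices U" "y \<in> vertices U"
      by (auto simp: card_2_iff)
    then have "(x, y) \<in> connection U" "(x, x) \<in> connection U"
      using e by (auto simp: connection_def)
    then have "e \<subseteq> connection U `` {x}" using xy by auto
    moreover have "connection U `` {x} \<in> vertices U // connection U" using xy by (intro quotientI)
    ultimately show ?thesis using e by (auto simp: components_def)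
  qed
  then have "\<Union>(edges ` components U) = edges U"
    using component_subgraph(1) by blast
  then show ?thesis using V by (simp add: prod_eq_iff)
qed

lemma graph_weight_components:
  assumes "simple_graph U"
  shows "graph_weight D U = (\<Prod>C\<in>components U. graph_weight D C)"
  using graph_weight_Union[OF finite_components[OF assms] component_simple[OF assms] components_disjoint]
  by (simp add: Union_components[OF assms])

text \<open>Closure propagates along a path from \<open>x\<close> to any other vertex of its
  class.\<close>

lemma component_connected:
  assumes U: "simple_graph U" and C: "C \<in> components U"
    and x: "x \<in> S" "x \<in> vertices C"
    and closed: "\<And>u v. {u, v} \<in> edges C \<Longrightarrow> u \<in> S \<Longrightarrow> v \<in> S"
  shows "vertices C \<subseteq> S"
proof
  fix y assume y: "y \<in> vertices C"
  obtain Q where Q: "Q \<in> vertices U // connection U" "C = (Q, {e \<in> edges U. e \<subseteq> Q})"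
    using C by (auto simp: components_def)
  have Qx: "Q = connection U `` {x}"
  proof -
    obtain z where z: "Q = connection U `` {z}" using Q by (auto elim: quotientE)
    then have "(z, x) \<in> connection U" using x Q by simp
    then show ?thesis unfolding z by (rule equiv_class_eq[OF equiv_connection[of U]])
  qed
  then have "(x, y) \<in> {(x, y). {x, y} \<in> edges U}\<^sup>*"
    using y Q by (auto simp: connection_def)
  \<comment> \<open>Membership in \<open>Q\<close> is carried along because \<open>closed\<close>
    applies only to edges inside the component.\<close>
  then have "y \<in> S \<and> y \<in> Q"
  proof (induction rule: rtrancl_induct)
    case base
    then show ?case using x Q by simp
  next
    case (step y z)
    then have yz: "{y, z} \<in> edges U" by simp
    then have "z \<in> vertices U" using U by (auto simp: simple_graph_def)
    then have "z \<in> Q"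
      using step yz unfolding Qx connection_def by (auto intro: rtrancl_into_rtrancl)
    then show ?case using closed[of y z] step yz Q by simp
  qed
  then show "y \<in> S" ..
qed

section \<open>Connected graphs\<close>

text \<open>Connectedness is stated through closed sets rather than paths: a property of one vertex
  that passes along edges then holds at all vertices.\<close>

definition connected_graph :: "'a ugraph \<Rightarrow> bool" where
  "connected_graph C \<longleftrightarrow> simple_graph C \<and> vertices C \<noteq> {} \<and>
     (\<forall>S. S \<inter> vertices C \<noteq> {} \<longrightarrow>
       (\<forall>u v. {u, v} \<in> edges C \<longrightarrow> u \<in> S \<longrightarrow> v \<in> S) \<longrightarrow> vertices C \<subseteq> S)"

lemma connected_graphD:
  assumes "connected_graph C" "x \<in> S" "x \<in> vertices C"
    and "\<And>u v. {u, v} \<in> edges C \<Longrightarrow> u \<in> S \<Longrightarrow> v \<in> S"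
  shows "vertices C \<subseteq> S"
  using assms unfolding connected_graph_def by blast

lemma connected_graph_component:
  assumes "simple_graph U" "C \<in> components U"
  shows "connected_graph C"
  unfolding connected_graph_def
proof (intro conjI allI impI)
  fix S assume "S \<inter> vertices C \<noteq> {}"
    and closed: "\<forall>u v. {u, v} \<in> edges C \<longrightarrow> u \<in> S \<longrightarrow> v \<in> S"
  then obtain x where "x \<in> S" "x \<in> vertices C" by blast
  then show "vertices C \<subseteq> S" using component_connected[OF assms] closed by blast
qed (use component_simple[OF assms] component_nonempty[OF assms(2)] in auto)

text \<open>The orbit is closed along edges: an edge is some \<open>{y, p y}\<close>, so following
  it applies \<open>p\<close> or its inverse, and the inverse is a power of \<open>p\<close> because
  \<open>p\<close> has finite order.\<close>

lemma edge_perms_orbit: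
  assumes C: "connected_graph C" and p: "p \<in> edge_perms C" and x: "x \<in> vertices C"
  shows "range (\<lambda>i. (p ^^ i) x) = vertices C"
proof
  have perm: "p permutes vertices C" using p by (simp add: edge_perms_def)
  show "range (\<lambda>i. (p ^^ i) x) \<subseteq> vertices C"
    using permutes_in_image[OF permutes_funpow[OF perm]] x by blast
  have "permutation p"
    using C perm permutes_imp_permutation by (auto simp: connected_graph_def simple_graph_def)
  then obtain m where m: "p ^^ m = id" "m > 0" using permutation_is_nilpotent by blast
  show "vertices C \<subseteq> range (\<lambda>i. (p ^^ i) x)"
  proof (rule connected_graphD[OF C _ x])
    show "x \<in> range (\<lambda>i. (p ^^ i) x)" by (rule range_eqI[of _ _ 0]) simp
    fix u v assume uv: "{u, v} \<in> edges C" "u \<in> range (\<lambda>i. (p ^^ i) x)"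
    then obtain i where i: "u = (p ^^ i) x" by blast
    obtain y where "{u, v} = {y, p y}" using uv(1) p by (auto simp: edge_perms_def)
    then consider "v = p u" | "u = p v" by (auto simp: doubleton_eq_iff)
    then show "v \<in> range (\<lambda>i. (p ^^ i) x)"
    proof cases
      case 1
      then show ?thesis using i by (intro range_eqI[of _ _ "Suc i"]) simp
    next
      case 2
      have "v = (p ^^ (m - 1 + 1)) v" using m by simp
      also have "\<dots> = (p ^^ (m - 1)) u" unfolding funpow_add using 2 by simp
      also have "\<dots> = (p ^^ (m - 1 + i)) x" unfolding i funpow_add by simp
      finally show ?thesis by blast
    qed
  qed
qed

lemma edge_perms_inv:
  assumes "p \<in> edge_perms C"
  shows "inv p \<in> edge_perms C"
proof -
  have perm: "p permutes vertices C" using assms by (simp add: edge_perms_def)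
  note pinv = permutes_inverses[OF perm]
  have "inv p x \<noteq> x" if "x \<in> vertices C" for x
    using assms that pinv(1)[of x] by (auto simp: edge_perms_def)
  \<comment> \<open>Writing a vertex \<open>x\<close> as \<open>inv p y\<close> turns the pair
    \<open>{x, p x}\<close> into \<open>{inv p y, y}\<close>.\<close>
  moreover have "(\<lambda>x. {x, p x}) ` vertices C = (\<lambda>x. {x, p x}) ` (inv p ` vertices C)"
    using permutes_image[OF permutes_inv[OF perm]] by simp
  then have "(\<lambda>x. {x, p x}) ` vertices C = (\<lambda>x. {x, inv p x}) ` vertices C"
    by (simp add: image_image pinv insert_commute)
  ultimately show ?thesis
    using assms permutes_inv[OF perm] by (simp add: edge_perms_def)
qed

text \<open>An edge of \<open>C\<close> at \<open>x\<close> leads to \<open>p x\<close> or to \<open>inv p x\<close>; by injectivity, a permutation \<open>q\<close> with the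
  same edges that agrees with \<open>p\<close> at one vertex also agrees with it at the next one.\<close>

lemma edge_perms_eq_or_inv:
  assumes C: "connected_graph C" and p: "p \<in> edge_perms C" and q: "q \<in> edge_perms C"
  shows "q = p \<or> q = inv p"
proof (cases "\<exists>x\<in>vertices C. q x = p x")
  case True
  then obtain x where x: "x \<in> vertices C" "q x = p x" by blast
  have pp: "p permutes vertices C" and qp: "q permutes vertices C"
    using p q by (auto simp: edge_perms_def)
  have step: "q (p y) = p (p y)" if y: "y \<in> vertices C" "q y = p y" for y
  proof -
    have py: "p y \<in> vertices C" using permutes_in_image[OF pp] y by blast
    have "{p y, q (p y)} \<in> edges C" using edge_perms_edge[OF q py] .
    then obtain w where "{p y, q (p y)} = {w, p w}" using p by (auto simp: edge_perms_def)
    then have ret: "q (p y) = p (p y) \<or> q (p y) = y"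
      using injD[OF permutes_inj[OF pp]] by (auto simp: doubleton_eq_iff)
    have "{p y, p (p y)} \<in> edges C" using edge_perms_edge[OF p py] .
    then obtain z where "{p y, p (p y)} = {z, q z}" using q by (auto simp: edge_perms_def)
    then have "q (p y) = p (p y) \<or> p (p y) = y"
      using injD[OF permutes_inj[OF qp]] y(2) by (auto simp: doubleton_eq_iff)
    \<comment> \<open>If both maps step back from \<open>p y\<close>, they step back to the same
      vertex \<open>y\<close> and so agree there too.\<close>
    then show ?thesis using ret by auto
  qed
  have "(p ^^ i) x \<in> vertices C \<and> q ((p ^^ i) x) = p ((p ^^ i) x)" for i
    by (induction i) (use x step permutes_in_image[OF pp] in auto)
  then have "q y = p y" if "y \<in> vertices C" for y
    using that unfolding edge_perms_orbit[OF C p x(1), symmetric] by blast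
  then have "q y = p y" for y
    using pp qp by (cases "y \<in> vertices C") (auto simp: permutes_def)
  then show ?thesis by blast
next
  case False
  have pp: "p permutes vertices C" and qp: "q permutes vertices C"
    using p q by (auto simp: edge_perms_def)
  \<comment> \<open>Since \<open>p\<close> and \<open>q\<close> differ at \<open>x\<close>, the edge
    from \<open>x\<close> to \<open>q x\<close> is not traced by \<open>p\<close> from
    \<open>x\<close>, so \<open>p\<close> traces it from \<open>q x\<close>.\<close>
  have "p (q x) = x" if x: "x \<in> vertices C" for x
  proof -
    have "{x, q x} \<in> edges C" using edge_perms_edge[OF q x] .
    then obtain z where "{x, q x} = {z, p z}" using p by (auto simp: edge_perms_def)
    then show ?thesis using False x by (auto simp: doubleton_eq_iff)
  qed
  moreover have "p (q x) = x" if "x \<notin> vertices C" for x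
    using that pp qp by (auto simp: permutes_def)
  ultimately have "q x = inv p x" for x
    using permutes_inverses(2)[OF pp, of "q x"] by metis
  then show ?thesis by blast
qed

lemma edge_perms_connected:
  assumes "connected_graph C" "p \<in> edge_perms C"
  shows "edge_perms C = {p, inv p}"
  using edge_perms_eq_or_inv[OF assms] edge_perms_inv[OF assms(2)] assms(2) by blast

text \<open>An involution has the orbit \<open>{x, p x}\<close>, which by connectedness would be the
  whole vertex set and have two elements.\<close>

lemma edge_perms_neq_inv:
  assumes C: "connected_graph C" and p: "p \<in> edge_perms C" and card: "card (vertices C) \<noteq> 2"
  shows "p \<noteq> inv p"
proof
  assume inv: "p = inv p"
  obtain x where x: "x \<in> vertices C" using C by (auto simp: connected_graph_def)
  have perm: "p permutes vertices C" using p by (simp add: edge_perms_def)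
  have pp: "p (p y) = y" for y using permutes_inverses(2)[OF perm, of y] inv by simp
  have "(p ^^ i) x \<in> {x, p x}" for i by (induction i) (auto simp: pp)
  then have "vertices C \<subseteq> {x, p x}" unfolding edge_perms_orbit[OF C p x, symmetric] by blast
  then have "vertices C = {x, p x}" using x permutes_in_image[OF perm, of x] by blast
  then show False using card p x by (auto simp: edge_perms_def)
qed

text \<open>Substituting \<open>p x\<close> for \<open>x\<close> reverses every pair, and
  skew-symmetry gives one sign per vertex.\<close>

lemma perm_weight_inv:
  assumes D: "is_orientation D G" and p: "p \<in> edge_perms C"
  shows "perm_weight D (inv p) = (-1) ^ card (vertices C) * perm_weight D p"
proof -
  have perm: "p permutes vertices C" using p by (simp add: edge_perms_def)
  have "perm_weight D (inv p) = (\<Prod>x\<in>vertices C. arc_sign D x (inv p x))"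
    by (rule perm_weight_edge_perms[OF edge_perms_inv[OF p]])
  also have "\<dots> = (\<Prod>x\<in>p ` vertices C. arc_sign D x (inv p x))"
    by (simp add: permutes_image[OF perm])
  also have "\<dots> = (\<Prod>x\<in>vertices C. arc_sign D (p x) x)"
    by (simp add: prod.reindex[OF permutes_inj_on[OF perm]] permutes_inverses[OF perm])
  also have "\<dots> = (\<Prod>x\<in>vertices C. - 1 * arc_sign D x (p x))"
    by (rule prod.cong) (simp_all add: arc_sign_swap[OF D, of "p _"])
  also have "\<dots> = (-1) ^ card (vertices C) * perm_weight D p"
    unfolding prod.distrib by (simp add: perm_weight_edge_perms[OF p])
  finally show ?thesis .
qed

text \<open>Every factor is 1 or -1, with -1 exactly where the move from \<open>x\<close> to
  \<open>p x\<close> follows an arc. This turns weights into the parity counts that define oddly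
  oriented cycles.\<close>

lemma perm_weight_power:
  assumes D: "is_orientation D G" and p: "p \<in> edge_perms C"
    and C: "finite (vertices C)" "edges C \<subseteq> edges G"
  shows "perm_weight D p = (-1) ^ card ((\<lambda>x. (x, p x)) ` vertices C \<inter> D)"
proof -
  have "perm_weight D p = (\<Prod>x\<in>vertices C. if (x, p x) \<in> D then -1 else 1)"
    unfolding perm_weight_edge_perms[OF p]
  proof (rule prod.cong)
    fix x assume "x \<in> vertices C"
    then have "{x, p x} \<in> edges G" using edge_perms_edge[OF p] C(2) by blast
    then show "arc_sign D x (p x) = (if (x, p x) \<in> D then -1 else 1)" by (rule arc_sign_edge[OF D])
  qed simp
  also have "\<dots> = (-1) ^ card {x \<in> vertices C. (x, p x) \<in> D}"
    using C(1) by (simp add: prod.If_cases Int_def)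
  also have "card {x \<in> vertices C. (x, p x) \<in> D} = card ((\<lambda>x. (x, p x)) ` {x \<in> vertices C. (x, p x) \<in> D})"
    by (rule card_image[symmetric]) (auto simp: inj_on_def)
  also have "(\<lambda>x. (x, p x)) ` {x \<in> vertices C. (x, p x) \<in> D} = (\<lambda>x. (x, p x)) ` vertices C \<inter> D"
    by auto
  finally show ?thesis .
qed

section \<open>Traversals of a cycle and the permutations tracing it\<close>

lemma map_eq_rotate1_nth:
  assumes "map p xs = rotate1 xs" "i < length xs"
  shows "p (xs ! i) = xs ! (Suc i mod length xs)"
proof -
  have "p (xs ! i) = map p xs ! i" using assms(2) by simp
  then show ?thesis using nth_rotate1[OF assms(2)] by (simp add: assms(1))
qed

lemma steps_perm:
  assumes "map p xs = rotate1 xs"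
  shows "steps xs = (\<lambda>x. (x, p x)) ` set xs"
  unfolding steps_def set_conv_nth using map_eq_rotate1_nth[OF assms] by force

text \<open>The witness sends each entry of the list to its cyclic successor, so the steps of the
  traversal become the pairs \<open>(x, p x)\<close>.\<close>

lemma traversal_edge_perm:
  assumes "traversal xs C"
  obtains p where "p \<in> edge_perms C" "steps xs = (\<lambda>x. (x, p x)) ` vertices C"
proof
  let ?p = "cycle_of_list xs"
  have xs: "distinct xs" "3 \<le> length xs" and V: "vertices C = set xs"
    and E: "edges C = {{x, y} | x y. (x, y) \<in> steps xs}"
    using assms by (auto simp: traversal_def)
  have rot: "map ?p xs = rotate1 xs" using cyclic_rotation[OF xs(1), of 1] by simp
  show steps: "steps xs = (\<lambda>x. (x, ?p x)) ` vertices C" using steps_perm[OF rot] V by simp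
  have "?p x \<noteq> x" if x: "x \<in> set xs" for x
  proof -
    obtain i where i: "i < length xs" "x = xs ! i" using x by (auto simp: in_set_conv_nth)
    have "?p x = xs ! (Suc i mod length xs)" using i map_eq_rotate1_nth[OF rot] by simp
    \<comment> \<open>With at least three entries the cyclic successor is another position, and by
      distinctness another vertex.\<close>
    moreover have "Suc i mod length xs \<noteq> i" "Suc i mod length xs < length xs"
      using i(1) xs(2) mod_Suc[of i "length xs"] by auto
    ultimately show ?thesis using i xs(1) by (simp add: nth_eq_iff_index_eq)
  qed
  moreover have "edges C = (\<lambda>x. {x, ?p x}) ` vertices C" unfolding E steps by auto
  ultimately show "?p \<in> edge_perms C" using cycle_permutes[of xs] V by (simp add: edge_perms_def)
qed

text \<open>The orbit list \<open>support p x\<close>, running through \<open>x\<close>,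
  \<open>p x\<close>, \<open>p (p x)\<close> and so on, visits every vertex once, and
  \<open>p\<close> rotates it.\<close>

lemma edge_perms_imp_cycle:
  assumes C: "connected_graph C" and p: "p \<in> edge_perms C" and card: "3 \<le> card (vertices C)"
  shows "is_cycle C"
proof -
  obtain x where x: "x \<in> vertices C" using C by (auto simp: connected_graph_def)
  let ?xs = "support p x"
  have perm: "permutation p"
    using C p permutes_imp_permutation by (auto simp: connected_graph_def simple_graph_def edge_perms_def)
  have dist: "distinct ?xs" by (rule cycle_of_permutation[OF perm])
  have set: "set ?xs = vertices C"
    using support_set[OF perm] edge_perms_orbit[OF C p x] by simp
  have "map p ?xs = rotate1 ?xs"
  proof (rule nth_equalityI)
    fix i assume "i < length (map p ?xs)"
    then have i: "i < least_power p x" by simp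
    have "map p ?xs ! i = (p ^^ Suc i) x" using i by simp
    also have "\<dots> = (p ^^ (Suc i mod least_power p x)) x"
    \<comment> \<open>At the last index the power reaches the period of \<open>x\<close> and wraps
      around to \<open>x\<close> itself.\<close>
    proof (cases "Suc i = least_power p x")
      case True
      then show ?thesis using least_power_of_permutation(1)[OF perm, of x] by (simp del: funpow.simps(2))
    qed (use i in \<open>simp add: Suc_lessI\<close>)
    also have "\<dots> = rotate1 ?xs ! i" using i by (simp add: nth_rotate1)
    finally show "map p ?xs ! i = rotate1 ?xs ! i" .
  qed simp
  then have steps: "steps ?xs = (\<lambda>x. (x, p x)) ` vertices C" unfolding set[symmetric] by (rule steps_perm)
  have "length ?xs = card (vertices C)" using distinct_card[OF dist] set by simp
  moreover have "edges C = {{x, y} | x y. (x, y) \<in> steps ?xs}"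
    unfolding steps using p by (auto simp: edge_perms_def)
  ultimately have "traversal ?xs C"
    unfolding traversal_def using dist set card by (simp add: prod_eq_iff)
  then show ?thesis by (auto simp: is_cycle_def)
qed

lemma is_single_edge_card: "is_single_edge C \<Longrightarrow> card (vertices C) = 2"
  by (auto simp: is_single_edge_def)

lemma is_cycle_card: "is_cycle C \<Longrightarrow> 3 \<le> card (vertices C)"
  by (auto simp: is_cycle_def traversal_def distinct_card)

text \<open>On fewer than three vertices there are only \<open>x\<close> and \<open>p x\<close>, and
  injectivity makes \<open>p\<close> swap them, which leaves one edge.\<close>

lemma edge_perms_imp_edge_or_cycle:
  assumes C: "connected_graph C" and p: "p \<in> edge_perms C"
  shows "is_single_edge C \<or> is_cycle C"
proof (cases "3 \<le> card (vertices C)")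
  case True
  then show ?thesis using edge_perms_imp_cycle[OF C p] by blast
next
  case False
  obtain x where x: "x \<in> vertices C" using C by (auto simp: connected_graph_def)
  have xp: "p x \<noteq> x" "p x \<in> vertices C"
    using p x permutes_in_image[of p "vertices C" x] by (auto simp: edge_perms_def)
  have V: "vertices C = {x, p x}"
  proof (rule card_seteq[symmetric])
    show "finite (vertices C)" using C by (auto simp: connected_graph_def simple_graph_def)
    show "{x, p x} \<subseteq> vertices C" using x xp by simp
    show "card (vertices C) \<le> card {x, p x}" using False xp by simp
  qed
  have "inj p" using p permutes_inj by (auto simp: edge_perms_def)
  then have "p (p x) \<noteq> p x" using xp by (auto dest: injD)
  then have "p (p x) = x"
    using p xp(2) V permutes_in_image[of p "vertices C" "p x"] by (auto simp: edge_perms_def)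
  then have "edges C = {{x, p x}}" using p V by (auto simp: edge_perms_def insert_commute)
  then show ?thesis unfolding is_single_edge_def using V xp(1) by (metis prod.collapse)
qed

section \<open>The weights of single edges and of cycles\<close>

text \<open>Only the transposition traces the edge. It contributes the entries for both directions,
  s and -s, where s is 1 or -1.\<close>

lemma graph_weight_single_edge:
  assumes D: "is_orientation D G" and C: "is_single_edge C" "edges C \<subseteq> edges G"
  shows "graph_weight D C = -1"
proof -
  obtain u v where uv: "u \<noteq> v" "C = ({u, v}, {{u, v}})" using C by (auto simp: is_single_edge_def)
  have "edge_perms C = {transpose u v}"
  proof
    show "{transpose u v} \<subseteq> edge_perms C"
      using uv by (auto simp: edge_perms_def permutes_swap_id insert_commute)
    show "edge_perms C \<subseteq> {transpose u v}"
    proof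
      fix p assume "p \<in> edge_perms C"
      then have p: "p permutes {u, v}" "p u \<noteq> u" "p v \<noteq> v" using uv by (auto simp: edge_perms_def)
      then have "p u = v" "p v = u" using permutes_in_image[OF p(1)] by blast+
      then have "p = transpose u v" using p(1) by (auto simp: fun_eq_iff permutes_def transpose_def)
      then show "p \<in> {transpose u v}" by simp
    qed
  qed
  moreover have "{x. transpose u v x \<noteq> x} = {u, v}" using uv(1) by (auto simp: transpose_def)
  ultimately have "graph_weight D C = arc_sign D u v * arc_sign D v u"
    using uv(1) by (simp add: graph_weight_def perm_weight_def)
  moreover have "arc_sign D u v = (if (u, v) \<in> D then -1 else 1)"
    using arc_sign_edge[OF D] C(2) uv(2) by simp
  ultimately show ?thesis by (simp add: arc_sign_swap[OF D, of v u])
qed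

text \<open>Exactly \<open>p\<close> and \<open>inv p\<close> trace the cycle, and their weights
  differ by one sign per vertex. They cancel for odd length; for even length they add up to twice
  the weight of \<open>p\<close>, which is -1 exactly when the number of agreeing steps is
  odd.\<close>

lemma graph_weight_cycle:
  assumes D: "is_orientation D G" and C: "connected_graph C" "is_cycle C" "edges C \<subseteq> edges G"
  shows "graph_weight D C =
    (if even (card (vertices C)) then if oddly_oriented D C then -2 else 2 else 0)"
proof -
  have fin: "finite (vertices C)" using C by (simp add: connected_graph_def simple_graph_def)
  have card: "3 \<le> card (vertices C)" by (rule is_cycle_card[OF C(2)])
  obtain xs where xs: "traversal xs C" using C(2) by (auto simp: is_cycle_def)
  obtain p where p: "p \<in> edge_perms C" using traversal_edge_perm[OF xs] .
  have gw: "graph_weight D C = perm_weight D p + (-1) ^ card (vertices C) * perm_weight D p"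
    using edge_perms_neq_inv[OF C(1) p] card
    by (simp add: graph_weight_def edge_perms_connected[OF C(1) p] perm_weight_inv[OF D p])
  show ?thesis
  proof (cases "even (card (vertices C))")
    case False
    then show ?thesis using gw by simp
  next
    case True
    \<comment> \<open>For even length both permutations have equal weight, so the parity is the same
      for every traversal, whatever its direction.\<close>
    have weight: "perm_weight D q = perm_weight D p" if "q \<in> edge_perms C" for q
      using that edge_perms_connected[OF C(1) p] perm_weight_inv[OF D p] True by auto
    have odd: "odd (card (steps ys \<inter> D)) \<longleftrightarrow> perm_weight D p = -1" if ys: "traversal ys C" for ys
    proof -
      obtain q where "q \<in> edge_perms C" "steps ys = (\<lambda>x. (x, q x)) ` vertices C"
        using traversal_edge_perm[OF ys] .
      then have "perm_weight D p = (-1) ^ card (steps ys \<inter> D)"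
        using perm_weight_power[OF D _ fin C(3)] weight by metis
      then show ?thesis by (simp add: minus_one_power_iff)
    qed
    \<comment> \<open>The traversal \<open>xs\<close> exists, so the universal quantifier in
      \<open>oddly_oriented\<close> is not vacuous.\<close>
    have "oddly_oriented D C \<longleftrightarrow> perm_weight D p = -1"
      unfolding oddly_oriented_def using odd xs by blast
    moreover have "perm_weight D p = 1 \<or> perm_weight D p = -1"
      unfolding perm_weight_power[OF D p fin C(3)] by (simp add: minus_one_power_iff)
    ultimately show ?thesis using gw True by auto
  qed
qed

section \<open>The weights of Sachs graphs\<close>

text \<open>A component that is neither an edge nor a cycle is traced by no permutation; its weight
  is an empty sum and annihilates the product.\<close>

lemma graph_weight_not_sachs:
  assumes "simple_graph U" "\<not> is_sachs_graph U"
  shows "graph_weight D U = 0"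
proof -
  obtain C where C: "C \<in> components U" "\<not> (is_single_edge C \<or> is_cycle C)"
    using assms by (auto simp: is_sachs_graph_def)
  have "edge_perms C = {}"
    using edge_perms_imp_edge_or_cycle[OF connected_graph_component[OF assms(1) C(1)]] C(2) by blast
  then have "graph_weight D C = 0" by (simp add: graph_weight_def)
  then show ?thesis
    unfolding graph_weight_components[OF assms(1)]
    using finite_components[OF assms(1)] C(1) by (simp add: prod_zero_iff) blast
qed

text \<open>The product over components splits into single edges, each giving -1, and cycles, each
  giving 2 or -2 if even and 0 if odd.\<close>

lemma graph_weight_sachs:
  assumes D: "is_orientation D G" and U: "is_sachs_graph U" "edges U \<subseteq> edges G"
  shows "graph_weight D U = (if \<forall>C\<in>cycles U. even (card (vertices C))
    then (-1) ^ (num_single_edges U + num_oddly_oriented_cycles D U) * 2 ^ num_cycles U else 0)"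
proof -
  have simple: "simple_graph U" using U(1) by (simp add: is_sachs_graph_def)
  note fin = finite_components[OF simple]
  have weight: "graph_weight D C =
    (if even (card (vertices C)) then if oddly_oriented D C then -2 else 2 else 0)"
    if "C \<in> cycles U" for C
    using that component_subgraph(1)[of C U] U(2) connected_graph_component[OF simple]
    by (intro graph_weight_cycle[OF D]) (auto simp: cycles_def)
  let ?E = "{C \<in> components U. is_single_edge C}"
  have comps: "components U = ?E \<union> cycles U"
    using U(1) by (auto simp: is_sachs_graph_def cycles_def)
  \<comment> \<open>A single edge has two vertices and a cycle at least three.\<close>
  have "?E \<inter> cycles U = {}"
    using is_single_edge_card is_cycle_card by (fastforce simp: cycles_def)
  moreover have "finite ?E" "finite (cycles U)" using fin by (auto simp: cycles_def)
  ultimately have "graph_weight D U = (\<Prod>C\<in>?E. graph_weight D C) * (\<Prod>C\<in>cycles U. graph_weight D C)"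
    unfolding graph_weight_components[OF simple] by (subst comps) (rule prod.union_disjoint)
  also have "(\<Prod>C\<in>?E. graph_weight D C) = (\<Prod>C\<in>?E. -1)"
    using component_subgraph(1)[of _ U] U(2)
    by (intro prod.cong refl graph_weight_single_edge[OF D]) auto
  also have "\<dots> = (-1) ^ num_single_edges U" by (simp add: num_single_edges_def)
  finally have gw: "graph_weight D U = (-1) ^ num_single_edges U * (\<Prod>C\<in>cycles U. graph_weight D C)" .
  show ?thesis
  proof (cases "\<forall>C\<in>cycles U. even (card (vertices C))")
    case True
    \<comment> \<open>With sign and 2 separated, one product counts the oddly oriented cycles and
      the other counts all cycles.\<close>
    have "(\<Prod>C\<in>cycles U. graph_weight D C) = (\<Prod>C\<in>cycles U. (if oddly_oriented D C then -1 else 1) * 2)"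
      by (rule prod.cong) (use weight True in auto)
    also have "\<dots> = (-1) ^ num_oddly_oriented_cycles D U * 2 ^ num_cycles U"
      using \<open>finite (cycles U)\<close>
      by (simp add: prod.distrib prod.If_cases num_oddly_oriented_cycles_def num_cycles_def Int_def)
    finally show ?thesis using gw True by (simp add: power_add)
  next
    case False
    then obtain C where "C \<in> cycles U" "graph_weight D C = 0" using weight by auto
    then have "(\<Prod>C\<in>cycles U. graph_weight D C) = 0"
      using \<open>finite (cycles U)\<close> by (meson prod_zero)
    then show ?thesis using gw False by simp
  qed
qed

text \<open>The components partition the vertices into sets of even size. This is why the odd
  coefficients vanish.\<close>

lemma even_card_sachs:
  assumes U: "is_sachs_graph U" and "\<forall>C\<in>cycles U. even (card (vertices C))"
  shows "even (card (vertices U))"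
proof -
  have simple: "simple_graph U" using U by (simp add: is_sachs_graph_def)
  have "vertices U = \<Union>(vertices ` components U)"
    using arg_cong[OF Union_components[OF simple], of fst] by simp
  then have "card (vertices U) = (\<Sum>C\<in>components U. card (vertices C))"
    using component_simple[OF simple] components_disjoint[of _ U]
    by (simp add: card_UN_disjoint[OF finite_components[OF simple]] simple_graph_def)
  moreover have "even (card (vertices C))" if C: "C \<in> components U" for C
  proof (cases "is_cycle C")
    case True
    then have "C \<in> cycles U" using C by (simp add: cycles_def)
    then show ?thesis using assms(2) by blast
  next
    case False
    then have "is_single_edge C" using C U by (auto simp: is_sachs_graph_def)
    then show ?thesis by (simp add: is_single_edge_card)
  qed
  ultimately show ?thesis by (simp add: dvd_sum)
qed

section \<open>The coefficients of the permanental polynomial\<close>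

lemma prod_constant_poly: "(\<Prod>x\<in>A. [:f x:]) = [:\<Prod>x\<in>A. f x:]"
  for f :: "'a \<Rightarrow> 'b::comm_semiring_1"
  by (induction A rule: infinite_finite_induct) (simp_all add: one_pCons mult.commute)

text \<open>Each fixed point of a permutation contributes the variable and each moved point an arc
  sign, so the exponent is the number of fixed points. The labelling disappears by carrying
  permutations of indices over to the vertices.\<close>

lemma permanental_poly_eq_sum:
  assumes D: "is_orientation D G" and v: "bij_betw v {0..<n} V"
  shows "permanental_poly n v D =
    (\<Sum>p | p permutes V. monom (perm_weight D p) (n - card {x. p x \<noteq> x}))"
proof -
  \<comment> \<open>The matrix entry in terms of vertices, with \<open>monom 1 1\<close> as the
    variable on the diagonal.\<close>
  define g where "g x y = (if y = x then monom 1 1 else [:arc_sign D x y:])" for x y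
  have V: "finite V" "card V = n"
    using v bij_betw_finite[OF v] bij_betw_same_card[OF v] by auto
  \<comment> \<open>The permutation \<open>q\<close> conjugated by the labelling and extended by the
    identity outside \<open>V\<close>.\<close>
  define lift where "lift q x = (if x \<in> V then v (q (inv_into {0..<n} v x)) else x)" for q x
  define M where "M = [:0, 1:] \<cdot>\<^sub>m 1\<^sub>m n - map_mat (\<lambda>c. [:c:]) (skew_adj_mat n v D)"
  have dim: "dim_row M = n" by (simp add: M_def skew_adj_mat_def)
  \<comment> \<open>The two directions of a loop would be the same pair, so exactly one of them
    could not be an arc; hence the skew adjacency matrix has zero diagonal.\<close>
  have irrefl: "(x, x) \<notin> D" for x using D unfolding is_orientation_def by blast
  have entry: "M $$ (i, j) = g (v i) (v j)" if "i < n" "j < n" for i j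
  proof -
    have "v j = v i \<longleftrightarrow> j = i" using v that by (auto simp: bij_betw_def inj_on_def)
    then show ?thesis
      using that irrefl by (auto simp: M_def g_def skew_adj_mat_def arc_sign_def monom_Suc monom_0)
  qed
  have "permanental_poly n v D = (\<Sum>q | q permutes {0..<n}. \<Prod>i = 0..<n. M $$ (i, q i))"
    unfolding permanental_poly_def permanent_def M_def[symmetric] dim ..
  also have "\<dots> = (\<Sum>q | q permutes {0..<n}. \<Prod>i = 0..<n. g (v i) (v (q i)))"
  proof (intro sum.cong prod.cong refl)
    fix q i assume "q \<in> {q. q permutes {0..<n}}" "i \<in> {0..<n}"
    then show "M $$ (i, q i) = g (v i) (v (q i))"
      using permutes_in_image[of q "{0..<n}" i] by (simp add: entry)
  qed
  also have "\<dots> = (\<Sum>q | q permutes {0..<n}. \<Prod>x\<in>V. g x (lift q x))"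
  proof (rule sum.cong)
    fix q
    have "(\<Prod>x\<in>V. g x (lift q x)) = (\<Prod>i = 0..<n. g (v i) (lift q (v i)))"
      by (rule prod.reindex_bij_betw[OF v, symmetric])
    also have "\<dots> = (\<Prod>i = 0..<n. g (v i) (v (q i)))"
      using v by (intro prod.cong) (auto simp: lift_def bij_betw_def)
    finally show "(\<Prod>i = 0..<n. g (v i) (v (q i))) = (\<Prod>x\<in>V. g x (lift q x))" ..
  qed simp
  also have "\<dots> = (\<Sum>p | p permutes V. \<Prod>x\<in>V. g x (p x))"
    using sum.reindex_bij_betw[OF bij_betw_permutations[OF v], of "\<lambda>p. \<Prod>x\<in>V. g x (p x)"]
    by (simp add: lift_def)
  also have "\<dots> = (\<Sum>p | p permutes V. monom (perm_weight D p) (n - card {x. p x \<noteq> x}))"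
  proof (rule sum.cong)
    fix p assume "p \<in> {p. p permutes V}"
    then have moved: "{x. p x \<noteq> x} \<subseteq> V" by (auto simp: permutes_def)
    have "(\<Prod>x\<in>V. g x (p x)) = (\<Prod>x\<in>V \<inter> {x. p x = x}. monom 1 1) * (\<Prod>x\<in>V \<inter> - {x. p x = x}. [:arc_sign D x (p x):])"
      unfolding g_def by (rule prod.If_cases[OF V(1)])
    also have "V \<inter> - {x. p x = x} = {x. p x \<noteq> x}" using moved by auto
    also have "V \<inter> {x. p x = x} = V - {x. p x \<noteq> x}" by auto
    also have "(\<Prod>x\<in>V - {x. p x \<noteq> x}. monom 1 1) = (monom 1 (n - card {x. p x \<noteq> x}) :: int poly)"
      using card_Diff_subset[OF finite_subset[OF moved V(1)] moved] V(2) by (simp add: monom_power)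
    finally show "(\<Prod>x\<in>V. g x (p x)) = monom (perm_weight D p) (n - card {x. p x \<noteq> x})"
      by (simp add: prod_constant_poly perm_weight_def smult_monom)
  qed simp
  finally show ?thesis .
qed

lemma permanental_poly_coeff:
  assumes D: "is_orientation D G" and v: "bij_betw v {0..<n} V" and k: "k \<le> n"
    and a: "permanental_poly n v D = (\<Sum>k = 0..n. monom (a k) (n - k))"
  shows "a k = (\<Sum>p | p permutes V \<and> card {x. p x \<noteq> x} = k. perm_weight D p)"
proof -
  have V: "finite V" "card V = n"
    using v bij_betw_finite[OF v] bij_betw_same_card[OF v] by auto
  \<comment> \<open>Truncated subtraction from \<open>n\<close> is injective on indices up to
    \<open>n\<close>, so the exponent \<open>n - k\<close> comes from \<open>j = k\<close>
    only.\<close>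
  have "coeff (\<Sum>j = 0..n. monom (a j) (n - j)) (n - k) = (\<Sum>j = 0..n. if j = k then a j else 0)"
    unfolding coeff_sum by (rule sum.cong) (use k in auto)
  then have "a k = coeff (permanental_poly n v D) (n - k)" unfolding a using k by simp
  also have "\<dots> = (\<Sum>p | p permutes V. if card {x. p x \<noteq> x} = k then perm_weight D p else 0)"
    unfolding permanental_poly_eq_sum[OF D v] coeff_sum
  proof (rule sum.cong)
    fix p assume "p \<in> {p. p permutes V}"
    then have "{x. p x \<noteq> x} \<subseteq> V" by (auto simp: permutes_def)
    \<comment> \<open>With at most \<open>n\<close> moved points, the truncated exponents again
      agree only if the counts do.\<close>
    then have "card {x. p x \<noteq> x} \<le> n" using card_mono V by metis
    then show "coeff (monom (perm_weight D p) (n - card {x. p x \<noteq> x})) (n - k) =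
        (if card {x. p x \<noteq> x} = k then perm_weight D p else 0)"
      using k by auto
  qed simp
  also have "\<dots> = (\<Sum>p | p permutes V \<and> card {x. p x \<noteq> x} = k. perm_weight D p)"
    unfolding sum.inter_filter[OF finite_permutations[OF V(1)], symmetric] by simp
  finally show ?thesis .
qed

section \<open>Grouping permutations by the subgraph they trace\<close>

lemma finite_subgraphs:
  assumes "simple_graph G"
  shows "finite {U. is_subgraph U G}"
proof (rule finite_subset)
  show "{U. is_subgraph U G} \<subseteq> Pow (vertices G) \<times> Pow (Pow (vertices G))"
    using assms by (force simp: is_subgraph_def simple_graph_def)
  show "finite (Pow (vertices G) \<times> Pow (Pow (vertices G)))"
    using assms by (simp add: simple_graph_def)
qed

text \<open>Both parts of the graph can be read off \<open>p\<close>: the vertices are the moved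
  points and the edges the pairs \<open>{x, p x}\<close>.\<close>

lemma edge_perms_unique:
  assumes "p \<in> edge_perms U" "p \<in> edge_perms W"
  shows "U = W"
proof -
  have "vertices U = vertices W" using edge_perms_moved assms by metis
  then show ?thesis using assms by (simp add: edge_perms_def prod_eq_iff)
qed

text \<open>A permutation that traces no subgraph of \<open>G\<close> moves some vertex along a
  non-edge and has a zero factor; the others are grouped by the unique graph they trace.\<close>

lemma sum_perm_weight_eq_graph_weight:
  assumes G: "simple_graph G" and D: "is_orientation D G"
  shows "(\<Sum>p | p permutes vertices G \<and> card {x. p x \<noteq> x} = k. perm_weight D p) =
    (\<Sum>U | is_subgraph U G \<and> card (vertices U) = k. graph_weight D U)"
proof -
  let ?P = "{p. p permutes vertices G \<and> card {x. p x \<noteq> x} = k}"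
  let ?S = "{U. is_subgraph U G \<and> card (vertices U) = k}"
  have finG: "finite (vertices G)" using G by (simp add: simple_graph_def)
  have finS: "finite ?S" by (rule finite_subset[OF _ finite_subgraphs[OF G]]) auto
  have "(\<Sum>p\<in>?P. perm_weight D p) = (\<Sum>p\<in>(\<Union>U\<in>?S. edge_perms U). perm_weight D p)"
  proof (rule sum.mono_neutral_right)
    show "finite ?P" by (rule finite_subset[OF _ finite_permutations[OF finG]]) auto
    show "(\<Union>U\<in>?S. edge_perms U) \<subseteq> ?P"
    proof
      fix p assume "p \<in> (\<Union>U\<in>?S. edge_perms U)"
      then obtain U where U: "is_subgraph U G" "card (vertices U) = k" "p \<in> edge_perms U" by blast
      then have "p permutes vertices G"
        using permutes_subset[of p "vertices U"] by (simp add: edge_perms_def is_subgraph_def)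
      then show "p \<in> ?P" using edge_perms_moved[OF U(3)] U(2) by simp
    qed
    show "\<forall>p\<in>?P - (\<Union>U\<in>?S. edge_perms U). perm_weight D p = 0"
    proof
      fix p assume p: "p \<in> ?P - (\<Union>U\<in>?S. edge_perms U)"
      let ?M = "{x. p x \<noteq> x}"
      have perm: "p permutes vertices G" using p by simp
      have M: "?M \<subseteq> vertices G" using perm by (auto simp: permutes_def)
      have "\<exists>x\<in>?M. {x, p x} \<notin> edges G"
      proof (rule ccontr)
        assume *: "\<not> (\<exists>x\<in>?M. {x, p x} \<notin> edges G)"
        \<comment> \<open>The graph traced by \<open>p\<close> on its moved points; if all these
          pairs were edges of \<open>G\<close>, it would be one of the subgraphs in the sum.\<close>
        let ?U = "(?M, (\<lambda>x. {x, p x}) ` ?M)"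
        \<comment> \<open>By injectivity a moved point goes to a moved point, so the edges of
          \<open>?U\<close> stay inside its vertex set.\<close>
        have "p x \<in> ?M" if "x \<in> ?M" for x
          using that injD[OF permutes_inj[OF perm], of "p x" x] by auto
        then have "simple_graph ?U"
          using finite_subset[OF M finG] by (auto simp: simple_graph_def card_2_iff)
        then have "?U \<in> ?S" using M * p by (auto simp: is_subgraph_def)
        moreover have "p permutes ?M" by (rule permutes_superset[OF perm]) auto
        then have "p \<in> edge_perms ?U" by (simp add: edge_perms_def)
        ultimately show False using p by blast
      qed
      then show "perm_weight D p = 0"
        unfolding perm_weight_def using arc_sign_eq_0[OF D] finite_subset[OF M finG]
        by (intro prod_zero) auto
    qed
  qed
  also have "\<dots> = (\<Sum>U\<in>?S. graph_weight D U)"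
    unfolding graph_weight_def
  proof (rule sum.UNION_disjoint[OF finS])
    show "\<forall>U\<in>?S. finite (edge_perms U)"
      using finite_edge_perms by (auto simp: is_subgraph_def simple_graph_def)
    show "\<forall>U\<in>?S. \<forall>W\<in>?S. U \<noteq> W \<longrightarrow> edge_perms U \<inter> edge_perms W = {}"
      using edge_perms_unique by blast
  qed
  finally show ?thesis .
qed

lemma graph_weight_subgraph:
  assumes D: "is_orientation D G" and U: "is_subgraph U G"
  shows "graph_weight D U = (if U \<in> even_sachs_subgraphs G (card (vertices U))
    then (-1) ^ (num_single_edges U + num_oddly_oriented_cycles D U) * 2 ^ num_cycles U else 0)"
proof (cases "is_sachs_graph U")
  case True
  then show ?thesis
    using graph_weight_sachs[OF D True] U by (simp add: is_subgraph_def even_sachs_subgraphs_def)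
next
  case False
  then show ?thesis
    using graph_weight_not_sachs[of U] U by (simp add: is_subgraph_def even_sachs_subgraphs_def)
qed

theorem theorem2p2:
  fixes G :: "'a ugraph" and D :: "('a \<times> 'a) set" and v :: "nat \<Rightarrow> 'a"
    and n k :: nat and a :: "nat \<Rightarrow> int"
  assumes "simple_graph G"
    and "bij_betw v {0..<n} (vertices G)"
    and "is_orientation D G"
    and "permanental_poly n v D = (\<Sum>k = 0..n. monom (a k) (n - k))"
    and "k \<le> n"
  shows "(even k \<longrightarrow> a k = (\<Sum>U\<in>even_sachs_subgraphs G k.
             (-1) ^ (num_single_edges U + num_oddly_oriented_cycles D U) * 2 ^ num_cycles U)) \<and>
         (odd k \<longrightarrow> a k = 0)"
proof -
  let ?S = "{U. is_subgraph U G \<and> card (vertices U) = k}"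
  let ?w = "\<lambda>U. (-1) ^ (num_single_edges U + num_oddly_oriented_cycles D U) * 2 ^ num_cycles U :: int"
  have "a k = (\<Sum>p | p permutes vertices G \<and> card {x. p x \<noteq> x} = k. perm_weight D p)"
    by (rule permanental_poly_coeff[OF assms(3,2,5,4)])
  also have "\<dots> = (\<Sum>U\<in>?S. graph_weight D U)"
    by (rule sum_perm_weight_eq_graph_weight[OF assms(1,3)])
  also have "\<dots> = (\<Sum>U\<in>?S. if U \<in> even_sachs_subgraphs G k then ?w U else 0)"
    by (rule sum.cong) (use graph_weight_subgraph[OF assms(3)] in auto)
  also have "\<dots> = (\<Sum>U | U \<in> ?S \<and> U \<in> even_sachs_subgraphs G k. ?w U)"
    by (rule sum.inter_filter[symmetric], rule finite_subset[OF _ finite_subgraphs[OF assms(1)]]) auto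
  also have "{U. U \<in> ?S \<and> U \<in> even_sachs_subgraphs G k} = even_sachs_subgraphs G k"
    by (auto simp: even_sachs_subgraphs_def)
  finally have ak: "a k = (\<Sum>U\<in>even_sachs_subgraphs G k. ?w U)" .
  \<comment> \<open>A Sachs graph without odd cycles has an even number of vertices, so for odd
    \<open>k\<close> the sum is empty.\<close>
  moreover have "even_sachs_subgraphs G k = {}" if "odd k"
    using that even_card_sachs unfolding even_sachs_subgraphs_def by blast
  ultimately show ?thesis by simp
qed

end
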